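(* Let $p$ be an odd prime. Let $\kappa\in\mathrm{Cl}\,\mathcal{O}_{\mathcal{K}}$ if $p\equiv 1\pmod 4$, and let $\kappa\in\mathrm{Cl}\,\mathcal{O}_{\mathcal{K}}\sqcup\mathrm{Cl}\,\mathcal{O}$ if $p\equiv 3\pmod 4$. Then $\kappa$ contains an ideal of the form $\mathfrak{a}=[1,\tau]$ with $\tau\in H$ such that $\omega_p\tau=A\tau$ for some $A\in\Gamma_0(p)$. Moreover, all elements $\tau\in H$ such that $[1,\tau]$ represents $\kappa$ and $\omega_p\tau=A\tau$ for some $A\in\Gamma_0(p)$ belong to a single $\Gamma_0(p)$-class $[\tau]_0=\Gamma_0(p)\tau$.
   Context: $H$ is the upper half-plane, and $\omega_p=\begin{pmatrix}0&1\\-p&0\end{pmatrix}$ acts on $H$ by $\tau\mapsto -1/(p\tau)$; $\Gamma_0(p)\subset SL_2(\mathbb{Z})$ acts by Möbius transformations. $\mathcal{K}=\mathbb{Q}(\sqrt{-p})\subset\mathbb{C}$, $\mathcal{O}_{\mathcal{K}}=[1,\beta_{-p}]$ is its ring of integers and $\mathcal{O}=[1,2\beta_{-p}]$ its order of conductor $2$, where $[x,y]=\mathbb{Z}x+\mathbb{Z}y$, $\beta_{-p}=\sqrt{-p}$ if $p\equiv 1\pmod 4$ and $\beta_{-p}=\frac{1+\sqrt{-p}}{2}$ if $p\equiv 3\pmod 4$. For an order $R$ of $\mathcal{K}$, a proper fractional $R$-ideal is a lattice $\mathfrak{a}\subset\mathcal{K}$ with $\{x\in\mathcal{K}: x\mathfrak{a}\subset\mathfrak{a}\}=R$,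 and $\mathrm{Cl}\,R$ is the group of proper fractional $R$-ideals modulo multiplication by $\mathcal{K}^*$. "Ideal" in the claim means proper fractional ideal. The union of the two class groups is taken as a disjoint union. *)

theory Defs
  imports "HOL-Analysis.Analysis" "HOL-Computational_Algebra.Computational_Algebra"
begin

definition upper_half_plane :: "complex set" where
  "upper_half_plane = {\<tau>. Im \<tau> > 0}"

definition moebius_act :: "int^2^2 \<Rightarrow> complex \<Rightarrow> complex" where
  "moebius_act A \<tau> = (of_int (A$1$1) * \<tau> + of_int (A$1$2)) / (of_int (A$2$1) * \<tau> + of_int (A$2$2))"

definition Gamma0 :: "nat \<Rightarrow> (int^2^2) set" where
  "Gamma0 p = {A. det A = 1 \<and> int p dvd A$2$1}"

definition Gamma0_class :: "nat \<Rightarrow> complex \<Rightarrow> complex set" where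
  "Gamma0_class p \<tau> = {moebius_act A \<tau> | A. A \<in> Gamma0 p}"

definition omega :: "nat \<Rightarrow> int^2^2" where
  "omega p = vector [vector [0, 1], vector [- int p, 0]]"

lemma moebius_act_omega: "moebius_act (omega p) \<tau> = - 1 / (of_nat p * \<tau>)"
  by (simp add: moebius_act_def omega_def vector_2)

definition sqrt_neg :: "nat \<Rightarrow> complex" where
  "sqrt_neg p = \<i> * complex_of_real (sqrt (real p))"

definition quad_field :: "nat \<Rightarrow> complex set" where
  "quad_field p = {of_rat a + of_rat b * sqrt_neg p | a b. True}"

definition int_span :: "complex \<Rightarrow> complex \<Rightarrow> complex set" where
  "int_span x y = {of_int m * x + of_int n * y | m n. True}"

(* Only meant for odd p, so the second case is p mod 4 = 3. *)
definition beta :: "nat \<Rightarrow> complex" where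
  "beta p = (if p mod 4 = 1 then sqrt_neg p else (1 + sqrt_neg p) / 2)"

definition max_order :: "nat \<Rightarrow> complex set" where
  "max_order p = {x \<in> quad_field p. algebraic_int x}"

(* The order of conductor 2 in max_order p = [1, beta p]; the latter equality is max_order_eq. *)
definition order2 :: "nat \<Rightarrow> complex set" where
  "order2 p = int_span 1 (2 * beta p)"

(* "independent" is linear independence over the reals; for x and y in the imaginary
   quadratic field this is the same as independence over the rationals. *)
definition lattice_in :: "complex set \<Rightarrow> complex set \<Rightarrow> bool" where
  "lattice_in K L \<longleftrightarrow> (\<exists>x\<in>K. \<exists>y\<in>K. x \<noteq> y \<and> independent {x, y} \<and> L = int_span x y)"

definition proper_ideals :: "nat \<Rightarrow> complex set \<Rightarrow> complex set set" where
  "proper_ideals p R =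
     {a. lattice_in (quad_field p) a \<and> {x \<in> quad_field p. (\<lambda>z. x * z) ` a \<subseteq> a} = R}"

definition ideal_equiv :: "nat \<Rightarrow> complex set \<Rightarrow> (complex set \<times> complex set) set" where
  "ideal_equiv p R = {(a, b). a \<in> proper_ideals p R \<and> b \<in> proper_ideals p R \<and>
     (\<exists>x\<in>quad_field p - {0}. b = (\<lambda>z. x * z) ` a)}"

(* The set of elements of the class group: a class is the set of all proper fractional
   R-ideals belonging to it. *)
definition Cl :: "nat \<Rightarrow> complex set \<Rightarrow> complex set set set" where
  "Cl p R = proper_ideals p R // ideal_equiv p R"

lemma quad_field_iff: "x \<in> quad_field p \<longleftrightarrow> (\<exists>a b. x = of_rat a + of_rat b * sqrt_neg p)"
  by (simp add: quad_field_def)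

lemma of_rat_complex_Re_Im [simp]:
  "Re (of_rat a) = of_rat a" "Im (of_rat a) = 0"
proof -
  have "(of_rat a :: complex) = of_real (of_rat a)"
    by (cases a) (simp add: of_rat_rat)
  then show "Re (of_rat a) = of_rat a" "Im (of_rat a) = 0"
    by (metis Re_complex_of_real, metis Im_complex_of_real)
qed

lemma sqrt_neg_Re_Im [simp]: "Re (sqrt_neg p) = 0" "Im (sqrt_neg p) = sqrt (real p)"
  by (simp_all add: sqrt_neg_def)

lemma sqrt_neg_square: "sqrt_neg p * sqrt_neg p = - of_nat p"
  by (simp add: complex_eq_iff)

lemma quad_field_mult:
  assumes "x \<in> quad_field p" "y \<in> quad_field p"
  shows "x * y \<in> quad_field p"
proof -
  obtain a b c d where x: "x = of_rat a + of_rat b * sqrt_neg p"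
    and y: "y = of_rat c + of_rat d * sqrt_neg p"
    using assms by (auto simp: quad_field_iff)
  have "x * y = of_rat a * of_rat c + of_rat b * of_rat d * (sqrt_neg p * sqrt_neg p)
      + (of_rat a * of_rat d + of_rat b * of_rat c) * sqrt_neg p"
    unfolding x y by (simp add: algebra_simps)
  also have "\<dots> = of_rat (a * c - of_nat p * b * d) + of_rat (a * d + b * c) * sqrt_neg p"
    unfolding sqrt_neg_square by (simp add: of_rat_add of_rat_diff of_rat_mult algebra_simps)
  finally show ?thesis by (auto simp: quad_field_iff)
qed

lemma quad_field_inverse:
  assumes "x \<in> quad_field p"
  shows "inverse x \<in> quad_field p"
proof -
  obtain a b where x: "x = of_rat a + of_rat b * sqrt_neg p"
    using assms by (auto simp: quad_field_iff)
  define N where "N = a\<^sup>2 + of_nat p * b\<^sup>2"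
  have Re_Im: "Re x = of_rat a" "Im x = of_rat b * sqrt (real p)"
    unfolding x by simp_all
  have "(Re x)\<^sup>2 + (Im x)\<^sup>2 = of_rat N"
    unfolding Re_Im N_def
    by (simp add: of_rat_add of_rat_mult of_rat_power power_mult_distrib mult.commute)
  then have "inverse x = of_rat (a / N) + of_rat (- b / N) * sqrt_neg p"
    by (simp add: complex_eq_iff Re_Im of_rat_divide[where 'a=real] of_rat_minus[where 'a=real])
  then show ?thesis by (auto simp: quad_field_iff)
qed

lemma ideal_equiv_sym: "(a, b) \<in> ideal_equiv p R \<Longrightarrow> (b, a) \<in> ideal_equiv p R"
proof -
  assume "(a, b) \<in> ideal_equiv p R"
  then obtain x where ab: "a \<in> proper_ideals p R" "b \<in> proper_ideals p R"
    and x: "x \<in> quad_field p" "x \<noteq> 0" "b = (\<lambda>z. x * z) ` a"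
    by (auto simp: ideal_equiv_def)
  have "a = (\<lambda>z. inverse x * z) ` b"
    using x by (auto simp: image_image mult.assoc[symmetric])
  moreover have "inverse x \<in> quad_field p - {0}"
    using x quad_field_inverse[of x p] by simp
  ultimately show ?thesis
    using ab unfolding ideal_equiv_def by blast
qed

lemma ideal_equiv_trans:
  assumes "(a, b) \<in> ideal_equiv p R" "(b, c) \<in> ideal_equiv p R"
  shows "(a, c) \<in> ideal_equiv p R"
proof -
  obtain x where ab: "a \<in> proper_ideals p R"
    and x: "x \<in> quad_field p" "x \<noteq> 0" "b = (\<lambda>z. x * z) ` a"
    using assms(1) by (auto simp: ideal_equiv_def)
  obtain y where c: "c \<in> proper_ideals p R"
    and y: "y \<in> quad_field p" "y \<noteq> 0" "c = (\<lambda>z. y * z) ` b"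
    using assms(2) by (auto simp: ideal_equiv_def)
  have "c = (\<lambda>z. (y * x) * z) ` a" using x y by (simp add: image_image mult.assoc)
  moreover have "y * x \<in> quad_field p - {0}"
    using x y quad_field_mult[of y p x] by simp
  ultimately show ?thesis
    using ab c unfolding ideal_equiv_def by blast
qed

lemma equiv_ideal_equiv: "equiv (proper_ideals p R) (ideal_equiv p R)"
proof (rule equivI)
  show "ideal_equiv p R \<subseteq> proper_ideals p R \<times> proper_ideals p R"
    by (auto simp: ideal_equiv_def)
  have "(1::complex) \<in> quad_field p"
    unfolding quad_field_iff by (rule exI[of _ 1], rule exI[of _ 0]) simp
  then show "refl_on (proper_ideals p R) (ideal_equiv p R)"
    by (auto simp: ideal_equiv_def refl_on_def intro!: bexI[of _ 1])
  show "sym (ideal_equiv p R)" using ideal_equiv_sym by (auto simp: sym_def)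
  show "trans (ideal_equiv p R)" using ideal_equiv_trans by (auto simp: trans_def)
qed

lemma poly_of_int_pCons:
  "poly (map_poly of_int (pCons c u)) x = of_int c + x * poly (map_poly of_int u) (x :: complex)"
  by (simp add: map_poly_pCons)

lemma poly_of_int_add:
  "poly (map_poly of_int (u + v)) x =
     poly (map_poly of_int u) x + poly (map_poly of_int v) (x :: complex)"
  by (induction u v rule: poly_induct2) (simp_all add: poly_of_int_pCons algebra_simps)

lemma poly_of_int_smult:
  "poly (map_poly of_int (smult c u)) x = of_int c * poly (map_poly of_int u) (x :: complex)"
  by (induction u) (simp_all add: poly_of_int_pCons algebra_simps)

lemma poly_of_int_mult:
  "poly (map_poly of_int (u * v)) x =
     poly (map_poly of_int u) x * poly (map_poly of_int v) (x :: complex)"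
  by (induction u)
    (simp_all add: poly_of_int_pCons poly_of_int_add poly_of_int_smult algebra_simps)

lemma algebraic_int_quadratic_dvd:
  fixes x :: complex and d t n :: int
  assumes x: "algebraic_int x" "Im x \<noteq> 0" and d: "d \<noteq> 0"
    and root: "of_int n + x * (of_int t + x * of_int d) = 0"
  shows "d dvd t" "d dvd n"
proof -
  obtain f :: "int poly" where f: "lead_coeff f = 1" "poly (map_poly of_int f) x = 0"
    using x(1) by (auto simp: algebraic_int_altdef_ipoly)
  define G where "G = [:n, t, d:]"
  have G0: "G \<noteq> 0" and degG: "degree G = 2" and lcG: "lead_coeff G = d"
    using d by (auto simp: G_def)
  have Gx: "poly (map_poly of_int G) x = 0"
    unfolding G_def using root by (simp add: poly_of_int_pCons)
  obtain q r where qr: "pseudo_divmod f G = (q, r)" by (cases "pseudo_divmod f G")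
  define c where "c = d ^ (Suc (degree f) - degree G)"
  have c0: "c \<noteq> 0" using d by (simp add: c_def)
  have eq: "smult c f = G * q + r" and r: "r = 0 \<or> degree r < degree G"
    using pseudo_divmod[OF G0 qr] lcG by (auto simp: c_def)
  have "poly (map_poly of_int r) x = 0"
    using arg_cong[OF eq, of "\<lambda>u. poly (map_poly of_int u) x"] f(2) Gx
    by (simp add: poly_of_int_smult poly_of_int_add poly_of_int_mult)
  moreover have "degree r \<le> 1" using r degG by auto
  then obtain r0 r1 where r01: "r = [:r0, r1:]"
    by (metis degree1_coeffs One_nat_def degree_eq_zeroE le_Suc_eq le_zero_eq pCons_0_0)
  ultimately have rx: "of_int r0 + x * of_int r1 = 0"
    by (simp add: poly_of_int_pCons)
  from arg_cong[OF rx, of Im] have "r1 = 0" using x(2) by simp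
  with rx have "r = 0" by (simp add: r01)
  with eq have eq: "smult c f = G * q" by simp
  have lc: "c = d * lead_coeff q"
    using arg_cong[OF eq, of lead_coeff] f(1) lcG
    by (simp only: lead_coeff_smult lead_coeff_mult mult_1_right)
  have "Polynomial.content f dvd 1"
    using content_dvd_coeff[of f "degree f"] f(1) by simp
  then have "Polynomial.content f = 1"
    by (metis is_unit_normalize normalize_content)
  then have ct: "\<bar>c\<bar> = Polynomial.content G * Polynomial.content q"
    using arg_cong[OF eq, of Polynomial.content] by (simp add: content_mult)
  obtain e where e: "lead_coeff q = Polynomial.content q * e"
    using content_dvd_coeff[of q "degree q"] by (auto simp: dvd_def)
  have q0: "Polynomial.content q \<noteq> 0" using ct c0 by auto
  have "c dvd Polynomial.content G * Polynomial.content q"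
    using ct by (metis abs_dvd_iff dvd_refl)
  then have "(d * e) * Polynomial.content q dvd Polynomial.content G * Polynomial.content q"
    using lc e by (simp add: mult_ac)
  then have "d * e dvd Polynomial.content G"
    using q0 by simp
  then have dG: "d dvd Polynomial.content G" by (rule dvd_mult_left)
  show "d dvd t" "d dvd n"
    using dvd_trans[OF dG content_dvd_coeff[of G 1]] dvd_trans[OF dG content_dvd_coeff[of G 0]]
    by (simp_all add: G_def)
qed

lemma prime_times_square_dvd:
  fixes D u M P :: int
  assumes "prime P" "D \<noteq> 0" "P * u\<^sup>2 = M * D\<^sup>2"
  shows "D dvd u"
proof -
  have eq: "(P * u)\<^sup>2 = (P * M) * D\<^sup>2"
    using assms(3) by (simp add: power2_eq_square algebra_simps)
  then have "D\<^sup>2 dvd (P * u)\<^sup>2" by simp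
  then have "D dvd P * u" by (simp only: pow_divides_pow_iff zero_less_numeral)
  then obtain w where w: "P * u = D * w" by (auto simp: dvd_def)
  from eq have "w\<^sup>2 = P * M" using assms(2) unfolding w by (simp add: power_mult_distrib)
  then have "P dvd w" using assms(1) by (metis dvd_triv_left prime_dvd_power)
  then obtain v where "w = P * v" by (auto simp: dvd_def)
  with w have "u = D * v" using assms(1) by (auto simp: mult.left_commute)
  then show ?thesis by simp
qed

lemma max_order_half:
  assumes "prime p" "x \<in> max_order p"
  obtains t s N :: int where "2 * x = of_int t + of_int s * sqrt_neg p" "t\<^sup>2 + int p * s\<^sup>2 = 4 * N"
proof -
  have alg: "algebraic_int x" and "x \<in> quad_field p"
    using assms(2) by (auto simp: max_order_def)
  then obtain a b where x: "x = of_rat a + of_rat b * sqrt_neg p"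
    by (auto simp: quad_field_iff)
  have p0: "p > 0" using assms(1) prime_gt_0_nat by blast
  show ?thesis
  proof (cases "b = 0")
    case True
    then have "x \<in> \<rat>" using x by simp
    then obtain m where m: "x = of_int m"
      using rational_algebraic_int_is_int[OF alg] by (auto elim: Ints_cases)
    show ?thesis
      by (rule that[of "2 * m" 0 "m\<^sup>2"]) (simp_all add: m power2_eq_square)
  next
    case False
    obtain a1 a2 where a: "a = of_int a1 / of_int a2" "a2 \<noteq> 0"
      by (metis Fract_of_int_quotient Rat_cases less_int_code(1))
    obtain b1 b2 where b: "b = of_int b1 / of_int b2" "b2 \<noteq> 0"
      by (metis Fract_of_int_quotient Rat_cases less_int_code(1))
    define D A B where "D = a2 * b2" "A = a1 * b2" "B = b1 * a2"
    have D0: "D \<noteq> 0" using a b by (simp add: D_A_B_def)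
    have Dx: "of_int D * x = of_int A + of_int B * sqrt_neg p"
      unfolding x a(1) b(1) using a(2) b(2) by (simp add: D_A_B_def of_rat_divide field_simps)
    have "(of_int D * x - of_int A) * (of_int D * x - of_int A)
        = of_int B * of_int B * (sqrt_neg p * sqrt_neg p)"
      unfolding Dx by (simp add: algebra_simps)
    then have "of_int (A\<^sup>2 + int p * B\<^sup>2) + x * (of_int (- 2 * A * D) + x * of_int (D\<^sup>2)) = 0"
      unfolding sqrt_neg_square by (simp add: algebra_simps power2_eq_square)
    moreover have "Im x \<noteq> 0" using False p0 by (simp add: x)
    moreover have "D\<^sup>2 \<noteq> 0" using D0 by simp
    ultimately have "D\<^sup>2 dvd - 2 * A * D" "D\<^sup>2 dvd A\<^sup>2 + int p * B\<^sup>2"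
      using algebraic_int_quadratic_dvd[OF alg] by blast+
    then have "D dvd 2 * A" and "D\<^sup>2 dvd A\<^sup>2 + int p * B\<^sup>2"
      using D0 by (auto simp: power2_eq_square)
    then obtain t N where t: "2 * A = D * t" and N: "A\<^sup>2 + int p * B\<^sup>2 = D\<^sup>2 * N"
      by (auto simp: dvd_def)
    have N4: "(2 * A)\<^sup>2 + int p * (2 * B)\<^sup>2 = 4 * D\<^sup>2 * N"
      using N by (simp add: power_mult_distrib)
    then have "int p * (2 * B)\<^sup>2 = (4 * N - t\<^sup>2) * D\<^sup>2"
      unfolding t by (simp add: power_mult_distrib algebra_simps)
    then have "D dvd 2 * B"
      using prime_times_square_dvd[of "int p" D "2 * B"] D0 assms(1) by auto
    then obtain s where s: "2 * B = D * s" by (auto simp: dvd_def)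
    have "D\<^sup>2 * (t\<^sup>2 + int p * s\<^sup>2) = D\<^sup>2 * (4 * N)"
      using N4 unfolding t s by (simp add: power_mult_distrib algebra_simps)
    then have N': "t\<^sup>2 + int p * s\<^sup>2 = 4 * N" using D0 by simp
    have "of_int D * (2 * x) = 2 * (of_int A + of_int B * sqrt_neg p)"
      unfolding Dx[symmetric] by simp
    also have "\<dots> = of_int (2 * A) + of_int (2 * B) * sqrt_neg p"
      by (simp add: algebra_simps)
    also have "\<dots> = of_int D * (of_int t + of_int s * sqrt_neg p)"
      unfolding t s by (simp add: algebra_simps)
    finally have "2 * x = of_int t + of_int s * sqrt_neg p" using D0 by simp
    then show ?thesis using N' by (rule that)
  qed
qed

lemma max_order_eq:
  assumes p: "prime p" "odd p"
  shows "max_order p = int_span 1 (beta p)"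
proof (intro equalityI subsetI)
  fix x assume "x \<in> max_order p"
  then obtain t s N where x: "2 * x = of_int t + of_int s * sqrt_neg p"
    and N: "t\<^sup>2 + int p * s\<^sup>2 = 4 * N"
    using max_order_half p(1) by metis
  show "x \<in> int_span 1 (beta p)"
  proof (cases "p mod 4 = 1")
    case True
    then obtain k where k: "int p = 4 * k + 1"
      by (metis mod_mult_div_eq of_nat_1 of_nat_add of_nat_mult of_nat_numeral add.commute)
    have "t\<^sup>2 + s\<^sup>2 = 4 * (N - k * s\<^sup>2)" using N unfolding k by (simp add: algebra_simps)
    then have mod0: "(t\<^sup>2 + s\<^sup>2) mod 4 = 0" by simp
    have "even t \<and> even s"
    proof (rule ccontr)
      assume "\<not> (even t \<and> even s)"
      moreover have "even (t\<^sup>2 + s\<^sup>2)" using mod0 by (metis dvd_eq_mod_eq_0 dvd_trans even_numeral)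
      ultimately have "odd t" "odd s" by auto
      then obtain i j where "t = 2 * i + 1" "s = 2 * j + 1" by (auto elim!: oddE)
      then have "t\<^sup>2 + s\<^sup>2 = 4 * (i\<^sup>2 + i + j\<^sup>2 + j) + 2" by (simp add: power2_eq_square algebra_simps)
      then have "(t\<^sup>2 + s\<^sup>2) mod 4 = 2" by (simp only: mod_mult_self4) simp
      with mod0 show False by simp
    qed
    then obtain i j where "t = 2 * i" "s = 2 * j" by (auto elim!: evenE)
    with x have "2 * x = 2 * (of_int i * 1 + of_int j * beta p)"
      using True by (simp add: beta_def algebra_simps)
    then have "x = of_int i * 1 + of_int j * beta p"
      by (metis mult_cancel_left zero_neq_numeral)
    then show ?thesis by (auto simp: int_span_def)
  next
    case False
    have "even (t\<^sup>2 + int p * s\<^sup>2)" unfolding N by simp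
    then have "even (t - s)" using p(2) by auto
    then obtain i where "t - s = 2 * i" by blast
    then have "t = s + 2 * i" by simp
    with x have "x = of_int i * 1 + of_int s * beta p"
      using False by (simp add: beta_def field_simps)
    then show ?thesis by (auto simp: int_span_def)
  qed
next
  fix x assume "x \<in> int_span 1 (beta p)"
  then obtain m n where x: "x = of_int m + of_int n * beta p" by (auto simp: int_span_def)
  define tr nm where "tr = (if p mod 4 = 1 then 2 * m else 2 * m + n)"
    and "nm = (if p mod 4 = 1 then m\<^sup>2 + int p * n\<^sup>2 else m\<^sup>2 + m * n + n\<^sup>2 * ((int p + 1) div 4))"
  have root: "of_int nm - of_int tr * x + x * x = 0"
  proof (cases "p mod 4 = 1")
    case True
    have "of_int nm - of_int tr * x + x * x
        = of_nat p * (of_int n)\<^sup>2 + (of_int n)\<^sup>2 * (sqrt_neg p * sqrt_neg p)"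
      unfolding x tr_def nm_def using True
      by (simp add: beta_def power2_eq_square algebra_simps)
    then show ?thesis by (simp add: sqrt_neg_square)
  next
    case False
    then have "p mod 4 = 3" using p(2) by presburger
    then have "int p mod 4 = 3" by presburger
    define j where "j = (int p + 1) div 4"
    have "4 * j = int p + 1" using \<open>int p mod 4 = 3\<close> unfolding j_def by presburger
    then have "of_int (4 * j) = (of_int (int p + 1) :: complex)" by (rule arg_cong)
    then have k: "of_nat p = (4 * of_int j - 1 :: complex)" by simp
    have "4 * (of_int nm - of_int tr * x + x * x)
        = (of_int n)\<^sup>2 * (4 * of_int j - 1) + (of_int n)\<^sup>2 * (sqrt_neg p * sqrt_neg p)"
      unfolding x tr_def nm_def j_def[symmetric] using False
      by (simp add: beta_def power2_eq_square field_simps)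
    also have "\<dots> = 0" unfolding sqrt_neg_square k by (simp add: algebra_simps)
    finally show ?thesis by (metis mult_eq_0_iff zero_neq_numeral)
  qed
  have "algebraic_int x"
    unfolding algebraic_int_altdef_ipoly
    by (rule exI[of _ "[:nm, - tr, 1:]"])
      (use root in \<open>simp add: poly_of_int_pCons algebra_simps\<close>)
  moreover have "x \<in> quad_field p"
  proof (cases "p mod 4 = 1")
    case True
    then have "x = of_rat (of_int m) + of_rat (of_int n) * sqrt_neg p"
      by (simp add: x beta_def)
    then show ?thesis unfolding quad_field_iff by blast
  next
    case False
    then have "x = of_rat (of_int m + of_int n / 2) + of_rat (of_int n / 2) * sqrt_neg p"
      by (simp add: x beta_def of_rat_add of_rat_divide of_rat_mult field_simps)
    then show ?thesis unfolding quad_field_iff by blast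
  qed
  ultimately show "x \<in> max_order p" by (simp add: max_order_def)
qed

lemma max_order_neq_order2:
  assumes p: "prime p" "odd p"
  shows "max_order p \<noteq> order2 p"
proof
  assume eq: "max_order p = order2 p"
  have p0: "p > 0" using p(1) prime_gt_0_nat by blast
  have "beta p \<in> max_order p"
    unfolding max_order_eq[OF p]
    unfolding int_span_def by (rule CollectI, rule exI[of _ 0], rule exI[of _ 1]) simp
  then obtain m n where mn: "beta p = of_int m + of_int n * (2 * beta p)"
    unfolding eq by (auto simp: order2_def int_span_def)
  have "Im (beta p) \<noteq> 0" using p0 by (simp add: beta_def Im_divide_numeral)
  moreover have "Im (beta p) = of_int (2 * n) * Im (beta p)"
    using arg_cong[OF mn, of Im] by (simp add: mult.commute)
  ultimately have "of_int (2 * n) = (1 :: real)" by simp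
  then have "2 * n = 1" by linarith
  then show False by presburger
qed

(* Hence the union of Cl p (max_order p) and Cl p (order2 p) is a disjoint union. *)
lemma Cl_disjoint:
  assumes "R \<noteq> S"
  shows "Cl p R \<inter> Cl p S = {}"
proof -
  have sub: "\<kappa> \<noteq> {} \<and> \<kappa> \<subseteq> proper_ideals p T" if "\<kappa> \<in> Cl p T" for \<kappa> T
    using that equiv_ideal_equiv[of p T] unfolding Cl_def
    by (metis in_quotient_imp_non_empty in_quotient_imp_subset)
  have "proper_ideals p R \<inter> proper_ideals p S = {}"
    using assms by (auto simp: proper_ideals_def)
  then show ?thesis using sub by blast
qed

end

theory Submission
  imports Defs
begin

text \<open>
  Write \<open>\<pi>\<close> for \<^term>\<open>sqrt_neg p\<close>, so that \<open>\<pi>\<^sup>2 = - p\<close>, and \<open>L\<close> for the lattice \<open>[1,\<tau>]\<close>.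
  The idea is to turn the condition \<open>\<omega>\<^sub>p \<tau> = A \<tau>\<close> into a statement about \<open>L\<close>: among lattices
  with \<open>\<pi> L \<subseteq> L\<close> it says exactly that \<open>\<pi> \<in> p L\<close>, equivalently \<open>1 \<in> \<pi> L\<close>.
  In moduli language, \<open>\<tau>\<close> stands for the elliptic curve \<open>\<complex> / L\<close> with its cyclic
  subgroup generated by \<open>1/p\<close>, and the condition says that this subgroup is the kernel of
  the endomorphism \<open>\<pi>\<close>.

  In one direction (\<open>fricke_fixed_imp_sqrt_neg_mem\<close>), the matrix \<open>A\<^sup>-\<^sup>1 \<omega>\<^sub>p\<close> fixes \<open>\<tau>\<close>, has
  determinant \<open>p\<close>, and its trace is a multiple \<open>p t\<close> of \<open>p\<close>. It is elliptic, so \<open>p t\<^sup>2 < 4\<close>,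
  which leaves \<open>t = 0\<close>, and \<open>t = \<plusminus>1\<close> for \<open>p = 3\<close>; either way its eigenvalue gives \<open>\<pi> \<in> p L\<close>.
  In the other direction (\<open>sqrt_neg_mem_imp_fricke_fixed\<close>), the matrix of multiplication by
  \<open>\<pi>\<close> on \<open>L\<close> is itself of the form \<open>A\<^sup>-\<^sup>1 \<omega>\<^sub>p\<close>.

  Both orders in question contain \<open>\<pi>\<close>, so \<open>\<pi> L \<subseteq> L\<close> for every lattice in the class \<open>\<kappa>\<close>.
  For existence, take any \<open>L = [x,y]\<close> in \<open>\<kappa>\<close>. One of \<open>\<pi> x\<close>, \<open>\<pi> y\<close> is a primitive vector of \<open>L\<close>:
  otherwise all four entries of the matrix of \<open>\<pi>\<close> would be divisible by \<open>p\<close>, although its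
  determinant is \<open>p\<close>. Dividing \<open>L\<close> by this vector gives a lattice \<open>[1,\<tau>]\<close> with \<open>1 \<in> \<pi> [1,\<tau>]\<close>.
  For uniqueness, if \<open>[1,\<tau>] = x [1,\<sigma>]\<close> and both lattices satisfy the condition, then
  \<open>\<pi> [1,\<sigma>] = [1, p \<sigma>]\<close>, hence \<open>1 \<in> x [1, p \<sigma>]\<close>; so the base change matrix from \<open>(\<sigma>,1)\<close> to
  \<open>(\<tau>,1)\<close> has its lower left entry divisible by \<open>p\<close>.
\<close>

section \<open>Lattices in the complex plane\<close>

lemma mem_int_span: "of_int m * x + of_int n * y \<in> int_span x y"
  by (auto simp: int_span_def)

lemma int_spanE:
  assumes "z \<in> int_span x y"
  obtains m n where "z = of_int m * x + of_int n * y"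
  using assms by (auto simp: int_span_def)

lemma int_span_generators: "x \<in> int_span x y" "y \<in> int_span x y"
  using mem_int_span[of 1 x 0 y] mem_int_span[of 0 x 1 y] by simp_all

lemma image_mult_int_span: "(\<lambda>z. c * z) ` int_span x y = int_span (c * x) (c * y)"
proof -
  have "c * (of_int m * x + of_int n * y) = of_int m * (c * x) + of_int n * (c * y)" for m n
    by (simp add: algebra_simps)
  then show ?thesis unfolding int_span_def by (auto simp: image_iff) metis+
qed

lemma int_span_subset:
  assumes "u \<in> int_span x y" "v \<in> int_span x y"
  shows "int_span u v \<subseteq> int_span x y"
proof
  fix z assume "z \<in> int_span u v"
  then obtain m n where z: "z = of_int m * u + of_int n * v" by (auto simp: int_span_def)
  obtain a b where u: "u = of_int a * x + of_int b * y" using assms(1) by (auto simp: int_span_def)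
  obtain c d where v: "v = of_int c * x + of_int d * y" using assms(2) by (auto simp: int_span_def)
  have "z = of_int (m * a + n * c) * x + of_int (m * b + n * d) * y"
    unfolding z u v by (simp add: algebra_simps)
  then show "z \<in> int_span x y" by (simp add: mem_int_span del: of_int_add of_int_mult)
qed

lemma int_span_unimodular:
  fixes a b r s :: int
  assumes "a * s - b * r = 1"
  shows "int_span (of_int a * x + of_int b * y) (of_int r * x + of_int s * y) = int_span x y"
    (is "int_span ?u ?v = _")
proof (rule equalityI)
  have det: "of_int a * of_int s - of_int b * of_int r = (1 :: complex)"
    using arg_cong[OF assms, of "of_int :: int \<Rightarrow> complex"] by simp
  have "of_int s * ?u + of_int (- b) * ?v = (of_int a * of_int s - of_int b * of_int r) * x"
    by (simp add: algebra_simps)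
  then have x: "x = of_int s * ?u + of_int (- b) * ?v" by (simp add: det)
  have "of_int (- r) * ?u + of_int a * ?v = (of_int a * of_int s - of_int b * of_int r) * y"
    by (simp add: algebra_simps)
  then have y: "y = of_int (- r) * ?u + of_int a * ?v" by (simp add: det)
  have "x \<in> int_span ?u ?v" "y \<in> int_span ?u ?v"
    by (subst x, rule mem_int_span) (subst y, rule mem_int_span)
  then show "int_span x y \<subseteq> int_span ?u ?v" by (rule int_span_subset)
  show "int_span ?u ?v \<subseteq> int_span x y" by (intro int_span_subset mem_int_span)
qed

lemma independent_imp_Im_cnj_mult_nonzero:
  fixes x y :: complex
  assumes "independent {x, y}" "x \<noteq> y"
  shows "Im (cnj x * y) \<noteq> 0"
proof
  assume 0: "Im (cnj x * y) = 0"
  have x: "x \<noteq> 0" using assms(1) dependent_zero by blast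
  have "cnj x * y = of_real (Re (cnj x * y))" using 0 by (simp add: complex_eq_iff)
  then have "x * cnj x * y = of_real (Re (cnj x * y)) * x" by (metis mult.commute mult.assoc)
  then have "y = of_real (Re (cnj x * y) / (cmod x)\<^sup>2) * x"
    using x by (simp add: complex_norm_square[symmetric] field_simps)
  then have "y \<in> span {x}"
    by (metis scaleR_conv_of_real span_base span_scale singletonI)
  moreover have "y \<notin> span ({x, y} - {y})"
    using assms(1) by (auto simp: dependent_def)
  ultimately show False using assms(2) by (simp add: insert_Diff_if)
qed

lemma int_combination_eq_iff:
  fixes x y :: complex and m n m' n' :: int
  assumes "Im (cnj x * y) \<noteq> 0"
  shows "of_int m * x + of_int n * y = of_int m' * x + of_int n' * y \<longleftrightarrow> m = m' \<and> n = n'"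
proof
  assume eq: "of_int m * x + of_int n * y = of_int m' * x + of_int n' * y"
  from arg_cong[OF eq, of "\<lambda>z. Im (cnj x * z)"]
  have "of_int n * Im (cnj x * y) = of_int n' * Im (cnj x * y)" by (simp add: algebra_simps)
  then have n: "n = n'" using assms by simp
  have "x \<noteq> 0" using assms by auto
  with eq n show "m = m' \<and> n = n'" by simp
qed simp

lemma int_combination_one_eq_iff:
  assumes "\<tau> \<in> upper_half_plane"
  shows "of_int m + of_int n * \<tau> = of_int m' + of_int n' * \<tau> \<longleftrightarrow> m = m' \<and> n = n'"
  using int_combination_eq_iff[of 1 \<tau> m n m' n'] assms by (simp add: upper_half_plane_def)

section \<open>Proper ideals and their classes\<close>

lemma proper_ideals_scale:
  assumes L: "L \<in> proper_ideals p R" and c: "c \<in> quad_field p" "c \<noteq> 0"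
  shows "(\<lambda>z. c * z) ` L \<in> proper_ideals p R"
proof -
  let ?L = "(\<lambda>z. c * z) ` L"
  obtain x y where xy: "x \<in> quad_field p" "y \<in> quad_field p" "x \<noteq> y" "independent {x, y}"
    and Lxy: "L = int_span x y"
    using L by (auto simp: proper_ideals_def lattice_in_def)
  have "linear (\<lambda>z. c * z)" by (rule linear_times)
  moreover have "inj_on (\<lambda>z. c * z) (span {x, y})" using c by (simp add: inj_on_def)
  ultimately have "independent ((\<lambda>z. c * z) ` {x, y})"
    using xy(4) by (metis linear_independent_injective_image)
  moreover have "c * x \<noteq> c * y" using xy c by simp
  moreover have "c * x \<in> quad_field p" "c * y \<in> quad_field p"
    using quad_field_mult[OF c(1)] xy(1,2) by blast+
  ultimately have "lattice_in (quad_field p) ?L"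
    unfolding lattice_in_def Lxy image_mult_int_span
    by (intro bexI[of _ "c * x"] bexI[of _ "c * y"]) simp_all
  moreover have "(\<lambda>z. x * z) ` ?L \<subseteq> ?L \<longleftrightarrow> (\<lambda>z. x * z) ` L \<subseteq> L" for x
  proof -
    have "(\<lambda>z. x * z) ` ?L = (\<lambda>z. c * z) ` (\<lambda>z. x * z) ` L"
      by (simp add: image_image mult_ac)
    moreover have "inj (\<lambda>z. c * z)" using c by (simp add: inj_on_def)
    ultimately show ?thesis by (simp add: inj_image_subset_iff)
  qed
  ultimately show ?thesis using L by (simp add: proper_ideals_def)
qed

lemma Cl_member_proper:
  assumes "\<kappa> \<in> Cl p R" "L \<in> \<kappa>"
  shows "L \<in> proper_ideals p R"
  using assms by (auto simp: Cl_def quotient_def ideal_equiv_def)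

lemma Cl_nonempty: "\<kappa> \<in> Cl p R \<Longrightarrow> \<kappa> \<noteq> {}"
  unfolding Cl_def using equiv_ideal_equiv in_quotient_imp_non_empty by blast

lemma Cl_scale:
  assumes \<kappa>: "\<kappa> \<in> Cl p R" and L: "L \<in> \<kappa>" and c: "c \<in> quad_field p" "c \<noteq> 0"
  shows "(\<lambda>z. c * z) ` L \<in> \<kappa>"
proof -
  have "L \<in> proper_ideals p R" by (rule Cl_member_proper[OF \<kappa> L])
  with proper_ideals_scale[OF this c] c have "(L, (\<lambda>z. c * z) ` L) \<in> ideal_equiv p R"
    unfolding ideal_equiv_def by auto
  then show ?thesis
    using equiv_ideal_equiv \<kappa> L unfolding Cl_def by (metis in_quotient_imp_closed)
qed

lemma Cl_members_homothetic:
  assumes "\<kappa> \<in> Cl p R" "L \<in> \<kappa>" "M \<in> \<kappa>"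
  obtains c where "c \<noteq> 0" "M = (\<lambda>z. c * z) ` L"
proof -
  have "(L, M) \<in> ideal_equiv p R"
    using assms equiv_ideal_equiv[of p R] unfolding Cl_def
    by (metis in_quotient_imp_in_rel insert_subset empty_subsetI)
  then show ?thesis using that by (auto simp: ideal_equiv_def)
qed

lemma proper_ideals_mult_closed:
  "L \<in> proper_ideals p R \<Longrightarrow> x \<in> R \<Longrightarrow> z \<in> L \<Longrightarrow> x * z \<in> L"
  unfolding proper_ideals_def by blast

lemma sqrt_neg_in_max_order:
  assumes "prime p" "odd p"
  shows "sqrt_neg p \<in> max_order p"
proof (cases "p mod 4 = 1")
  case True
  then show ?thesis
    unfolding max_order_eq[OF assms] by (simp add: beta_def int_span_generators)
next
  case False
  then have "sqrt_neg p = of_int (- 1) * 1 + of_int 2 * beta p"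
    by (simp add: beta_def field_simps)
  then show ?thesis unfolding max_order_eq[OF assms] by (metis mem_int_span)
qed

lemma sqrt_neg_in_order2:
  assumes "p mod 4 = 3"
  shows "sqrt_neg p \<in> order2 p"
proof -
  have "sqrt_neg p = of_int (- 1) * 1 + of_int 1 * (2 * beta p)" 
    using assms by (simp add: beta_def field_simps)
  then show ?thesis unfolding order2_def by (metis mem_int_span)
qed

lemma sqrt_neg_in_quad_field: "sqrt_neg p \<in> quad_field p"
  unfolding quad_field_iff by (rule exI[of _ 0], rule exI[of _ 1]) simp

section \<open>Points with \<open>\<omega>\<^sub>p \<tau> \<in> \<Gamma>\<^sub>0(p) \<tau>\<close>\<close>

text \<open>
  The fixed point equation of \<open>A\<^sup>-\<^sup>1 \<omega>\<^sub>p\<close> is \<open>p a \<tau>\<^sup>2 + p (b + c) \<tau> + d = 0\<close>, where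
  \<open>a, b, p c, d\<close> are the entries of \<open>A\<close>. Its discriminant \<open>p\<^sup>2 (b - c)\<^sup>2 - 4 p\<close> is negative,
  which forces \<open>b = c\<close>, or \<open>p = 3\<close> and \<open>\<bar>b - c\<bar> = 1\<close>.
\<close>

lemma fricke_fixed_imp_sqrt_neg_mem:
  assumes p: "p \<ge> 3" and \<tau>: "\<tau> \<in> upper_half_plane" and A: "A \<in> Gamma0 p"
    and fixed: "moebius_act (omega p) \<tau> = moebius_act A \<tau>"
  obtains m n :: int where "sqrt_neg p = of_nat p * (of_int m + of_int n * \<tau>)"
proof -
  define a b d where "a = A$1$1" and "b = A$1$2" and "d = A$2$2"
  obtain c where c: "A$2$1 = int p * c" using A by (auto simp: Gamma0_def)
  have det: "a * d - int p * b * c = 1"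
    using A by (simp add: Gamma0_def det_2 c a_def b_def d_def mult_ac)
  have p0: "(of_nat p :: complex) \<noteq> 0" using p by simp
  have Im\<tau>: "Im \<tau> > 0" using \<tau> by (simp add: upper_half_plane_def)
  then have \<tau>0: "\<tau> \<noteq> 0" by auto
  have a0: "a \<noteq> 0"
  proof
    assume "a = 0"
    with det have "int p * (- (b * c)) = 1" by simp
    then have "int p dvd 1" by (metis dvd_triv_left)
    then show False using p by simp
  qed
  have eq: "- 1 / (of_nat p * \<tau>) = (of_int a * \<tau> + of_int b) / (of_nat p * of_int c * \<tau> + of_int d)"
    using fixed unfolding moebius_act_omega
    by (simp add: moebius_act_def c a_def b_def d_def)
  have den: "of_nat p * of_int c * \<tau> + of_int d \<noteq> 0"
    using eq p0 \<tau>0 by auto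
  have quad: "of_nat p * of_int a * \<tau>\<^sup>2 + of_nat p * of_int (b + c) * \<tau> + of_int d = 0"
  proof -
    have "- (of_nat p * of_int c * \<tau> + of_int d) = (of_int a * \<tau> + of_int b) * (of_nat p * \<tau>)"
      using eq den p0 \<tau>0 by (subst (asm) frac_eq_eq) simp_all
    then have "(of_int a * \<tau> + of_int b) * (of_nat p * \<tau>) + (of_nat p * of_int c * \<tau> + of_int d) = 0"
      by (metis add.left_inverse)
    then show ?thesis by (simp add: algebra_simps power2_eq_square)
  qed
  \<comment> \<open>\<open>z = \<plusminus>\<surd>D\<close> by completing the square, where \<open>D\<close> is the discriminant; up to sign, \<open>z\<close> is
    the difference of the two eigenvalues of \<open>A\<^sup>-\<^sup>1 \<omega>\<^sub>p\<close>\<close>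
  define z where "z = of_nat p * (of_int (b + c) + of_int (2 * a) * \<tau>)"
  define D where "D = int p * (int p * (b - c)\<^sup>2 - 4)"
  have "z\<^sup>2 = of_nat p * (of_nat p * (of_int (b + c))\<^sup>2) + 4 * of_nat p * of_int a *
      (of_nat p * of_int a * \<tau>\<^sup>2 + of_nat p * of_int (b + c) * \<tau> + of_int d) - 4 * of_nat p * of_int (a * d)"
    by (simp add: z_def power2_eq_square algebra_simps)
  also have "\<dots> = of_int (int p * (int p * (b + c)\<^sup>2) - 4 * int p * (a * d))" unfolding quad by simp
  also have "a * d = 1 + int p * b * c" using det by simp
  also have "int p * (int p * (b + c)\<^sup>2) - 4 * int p * (1 + int p * b * c) = D"
    by (simp add: D_def power2_eq_square algebra_simps)
  finally have zz: "z\<^sup>2 = of_int D" .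
  have Imz: "Im z \<noteq> 0" using a0 Im\<tau> p by (simp add: z_def)
  have Rez: "Re z = 0" using arg_cong[OF zz, of Im] Imz by (simp add: power2_eq_square)
  have "of_int D = - (Im z)\<^sup>2" using arg_cong[OF zz, of Re] Rez by (simp add: power2_eq_square)
  also have "\<dots> < 0" using Imz by simp
  finally have "D < 0" by (simp only: of_int_less_0_iff)
  then have "int p * (b - c)\<^sup>2 < 4" using p by (simp add: D_def mult_less_0_iff)
  moreover have "3 * (b - c)\<^sup>2 \<le> int p * (b - c)\<^sup>2" using p by (intro mult_right_mono) auto
  moreover have "(b - c)\<^sup>2 \<ge> 0" by simp
  ultimately consider "(b - c)\<^sup>2 = 0" | "(b - c)\<^sup>2 = 1" by linarith
  then show ?thesis
  proof cases
    case 1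
    then have bc: "c = b" by simp
    have "z = 2 * (of_nat p * (of_int b + of_int a * \<tau>))"
      unfolding z_def bc by (simp add: algebra_simps)
    moreover have "z\<^sup>2 = (2 * sqrt_neg p)\<^sup>2"
      unfolding zz D_def bc by (simp add: power_mult_distrib power2_eq_square sqrt_neg_square)
    ultimately have "sqrt_neg p = of_nat p * (of_int b + of_int a * \<tau>) \<or>
        sqrt_neg p = - (of_nat p * (of_int b + of_int a * \<tau>))"
      by (auto simp: power2_eq_iff)
    then show ?thesis using that[of b a] that[of "- b" "- a"] by (auto simp: algebra_simps)
  next
    case 2
    with \<open>int p * (b - c)\<^sup>2 < 4\<close> have "p = 3" using p by simp
    then have "z\<^sup>2 = (sqrt_neg p)\<^sup>2"
      unfolding zz D_def 2 by (simp add: power2_eq_square sqrt_neg_square)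
    then have "sqrt_neg p = z \<or> sqrt_neg p = - z" by (auto simp: power2_eq_iff)
    then show ?thesis
      using that[of "b + c" "2 * a"] that[of "- (b + c)" "- 2 * a"] by (auto simp: z_def algebra_simps)
  qed
qed

text \<open>
  Since \<open>\<pi>\<^sup>2 = - p\<close>, the matrix of multiplication by \<open>\<pi>\<close> on \<open>[1,\<tau>]\<close> has trace zero and
  determinant \<open>p\<close>. The hypothesis \<open>\<pi> \<in> p [1,\<tau>]\<close> makes one row divisible by \<open>p\<close>: the
  trace then fixes the coefficient of \<open>\<tau>\<close> in \<open>\<pi> \<tau>\<close>, and the determinant becomes \<open>p\<close> times
  that of an element of \<open>\<Gamma>\<^sub>0(p)\<close>.
\<close>

lemma sqrt_neg_mult_matrix:
  assumes p: "p > 0" and \<tau>: "\<tau> \<in> upper_half_plane"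
    and mem: "sqrt_neg p = of_nat p * (of_int b + of_int a * \<tau>)"
    and closed: "sqrt_neg p * \<tau> \<in> int_span 1 \<tau>"
  obtains d where "sqrt_neg p * \<tau> = of_int (- d) + of_int (- int p * b) * \<tau>"
    "a * d - int p * b\<^sup>2 = 1"
proof -
  let ?r = "sqrt_neg p"
  obtain k l where kl: "?r * \<tau> = of_int k + of_int l * \<tau>"
    using closed by (auto simp: int_span_def)
  have "a \<noteq> 0" using arg_cong[OF mem, of Im] p by auto
  have "- of_nat p = ?r * (of_nat p * (of_int b + of_int a * \<tau>))"
    unfolding mem[symmetric] sqrt_neg_square ..
  also have "\<dots> = of_nat p * (of_int b * ?r + of_int a * (?r * \<tau>))" by (simp add: algebra_simps)
  also have "\<dots> = of_nat p * (of_int b * (of_nat p * (of_int b + of_int a * \<tau>)) +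
      of_int a * (of_int k + of_int l * \<tau>))"
    unfolding kl mem[symmetric] ..
  finally have "of_nat p * (- 1) = of_nat p * (of_int b * (of_nat p * (of_int b + of_int a * \<tau>)) +
      of_int a * (of_int k + of_int l * \<tau>))" by simp
  then have "- 1 = of_int b * (of_nat p * (of_int b + of_int a * \<tau>)) +
      of_int a * (of_int k + of_int l * \<tau>)" using p by (metis mult_cancel_left of_nat_eq_0_iff neq0_conv)
  then have "of_int (- 1) + of_int 0 * \<tau> =
      of_int (int p * b\<^sup>2 + a * k) + of_int (a * (int p * b + l)) * \<tau>"
    by (simp add: power2_eq_square algebra_simps)
  then have eqs: "- 1 = int p * b\<^sup>2 + a * k" "a * (int p * b + l) = 0"
    unfolding int_combination_one_eq_iff[OF \<tau>] by simp_all
  then have l: "l = - int p * b" using \<open>a \<noteq> 0\<close> by simp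
  show ?thesis
    by (rule that[of "- k"]) (use kl l eqs(1) in simp_all)
qed

text \<open>
  The witness \<open>A\<close> is \<open>- \<omega>\<^sub>p M\<^sup>-\<^sup>1\<close>, where \<open>M\<close> is the matrix of multiplication by \<open>\<pi>\<close> in the basis
  \<open>(\<tau>,1)\<close>. As \<open>(\<tau>,1)\<close> is an eigenvector of \<open>M\<close>, the action of \<open>M\<close> fixes \<open>\<tau>\<close>.
\<close>

lemma sqrt_neg_mem_imp_fricke_fixed:
  assumes p: "p > 0" and \<tau>: "\<tau> \<in> upper_half_plane"
    and mem: "sqrt_neg p = of_nat p * (of_int b + of_int a * \<tau>)"
    and closed: "sqrt_neg p * \<tau> \<in> int_span 1 \<tau>"
  shows "\<exists>A\<in>Gamma0 p. moebius_act (omega p) \<tau> = moebius_act A \<tau>"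
proof -
  obtain d where d: "sqrt_neg p * \<tau> = of_int (- d) + of_int (- int p * b) * \<tau>"
    and det: "a * d - int p * b\<^sup>2 = 1"
    using sqrt_neg_mult_matrix[OF assms] by metis
  define A :: "int^2^2" where "A = vector [vector [a, b], vector [int p * b, d]]"
  have "A \<in> Gamma0 p"
    using det by (simp add: Gamma0_def A_def det_2 vector_2 power2_eq_square algebra_simps)
  moreover have "moebius_act (omega p) \<tau> = moebius_act A \<tau>"
  proof -
    have Im\<tau>: "Im \<tau> > 0" using \<tau> by (simp add: upper_half_plane_def)
    then have \<tau>0: "\<tau> \<noteq> 0" by auto
    have "of_int a * \<tau> + of_int b \<noteq> 0"
    proof
      assume "of_int a * \<tau> + of_int b = 0"
      then have "sqrt_neg p = 0" unfolding mem by (simp add: add.commute)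
      then show False using p by (simp add: sqrt_neg_def)
    qed
    \<comment> \<open>the quadratic equation of \<open>\<tau>\<close> says that the denominator of \<open>A \<tau>\<close> is \<open>- p \<tau>\<close> times the
      numerator\<close>
    moreover have den: "of_int (int p * b) * \<tau> + of_int d = - (of_nat p * \<tau>) * (of_int a * \<tau> + of_int b)"
      using d unfolding mem by (simp add: algebra_simps)
    ultimately show ?thesis
      unfolding moebius_act_omega using p \<tau>0
      by (simp add: moebius_act_def A_def vector_2 den del: of_int_mult)
  qed
  ultimately show ?thesis by blast
qed

section \<open>Existence\<close>

text \<open>
  A vector that starts a basis of \<open>[x,y]\<close> is found inside \<open>\<pi> [x,y]\<close>, and even among \<open>\<pi> x\<close>
  and \<open>\<pi> y\<close>. The matrix of \<open>\<pi>\<close> on \<open>[x,y]\<close> has trace zero and determinant \<open>p\<close>, so the gcd of each of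
  its rows divides \<open>p\<close>, and \<open>p\<close> cannot divide all entries.
\<close>

lemma sqrt_neg_primitive_image:
  assumes p: "prime p" and xy: "Im (cnj x * y) \<noteq> 0"
    and closed: "sqrt_neg p * x \<in> int_span x y" "sqrt_neg p * y \<in> int_span x y"
  obtains u w where "u \<in> int_span x y" "int_span (sqrt_neg p * u) w = int_span x y"
proof -
  let ?r = "sqrt_neg p"
  obtain a b where ab: "?r * x = of_int a * x + of_int b * y"
    using closed(1) by (auto simp: int_span_def)
  obtain c d where cd: "?r * y = of_int c * x + of_int d * y"
    using closed(2) by (auto simp: int_span_def)
  have "of_int (- int p) * x + of_int 0 * y = ?r * (?r * x)"
    by (simp add: mult.assoc[symmetric] sqrt_neg_square)
  also have "\<dots> = of_int a * (?r * x) + of_int b * (?r * y)"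
    by (subst ab) (simp add: algebra_simps)
  also have "\<dots> = of_int (a * a + b * c) * x + of_int (b * (a + d)) * y"
    unfolding ab cd by (simp add: algebra_simps)
  finally have det: "- int p = a * a + b * c" and "b * (a + d) = 0"
    unfolding int_combination_eq_iff[OF xy] by simp_all
  moreover have "b \<noteq> 0"
  proof
    assume "b = 0"
    with det have "a * a = - int p" by simp
    moreover have "a * a \<ge> 0" by simp
    ultimately show False using prime_gt_0_nat[OF p] by linarith
  qed
  ultimately have d: "d = - a" by simp
  have pp: "prime (int p)" using p by simp
  have gcd_dvd: "coprime m n \<or> int p dvd m \<and> int p dvd n" if "gcd m n dvd int p" for m n :: int
  proof -
    have "is_unit (gcd m n) \<or> int p dvd gcd m n"
      using prime_elem_imp_irreducible[OF prime_imp_prime_elem[OF pp]] that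
      by (auto simp: irreducible_altdef)
    then show ?thesis by (auto simp: is_unit_gcd)
  qed
  have "gcd a b dvd a * a + b * c" "gcd c a dvd a * a + b * c"
    by (simp_all add: dvd_add)
  then have dvd: "gcd a b dvd int p" "gcd c a dvd int p"
    unfolding det[symmetric] by simp_all
  have "coprime a b \<or> coprime c a"
  proof (rule ccontr)
    assume "\<not> ?thesis"
    then have "int p dvd a" "int p dvd b" "int p dvd c" using gcd_dvd dvd by blast+
    then have "int p * int p dvd a * a + b * c" by (intro dvd_add mult_dvd_mono)
    then have "int p * int p dvd int p * 1" unfolding det[symmetric] by simp
    then have "int p dvd 1" using pp by (metis dvd_mult_cancel_left not_prime_0)
    then show False using pp not_prime_unit by blast
  qed
  then show ?thesis
  proof
    assume "coprime a b"
    then obtain s r where "s * a + r * b = 1" by (metis bezout_int coprime_imp_gcd_eq_1)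
    then have "a * s - b * (- r) = 1" by (simp add: algebra_simps)
    from int_span_unimodular[OF this, of x y]
    show ?thesis unfolding ab[symmetric] using that int_span_generators(1) by blast
  next
    assume "coprime c a"
    then obtain s r where "s * c + r * a = 1" by (metis bezout_int coprime_imp_gcd_eq_1)
    then have "c * s - d * r = 1" by (simp add: d algebra_simps)
    from int_span_unimodular[OF this, of x y]
    show ?thesis unfolding cd[symmetric] using that int_span_generators(2) by blast
  qed
qed

text \<open>
  Dividing a lattice \<open>L\<close> of the class by a primitive vector \<open>v = \<pi> u\<close> with \<open>u \<in> L\<close> turns \<open>v\<close>
  into the basis vector \<open>1\<close> and \<open>u\<close> into \<open>\<pi>\<^sup>-\<^sup>1 = - \<pi> / p\<close>.
\<close>

lemma class_contains_normalized_lattice: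
  assumes p: "prime p" and \<kappa>: "\<kappa> \<in> Cl p R" and R: "sqrt_neg p \<in> R"
  obtains \<tau> m n where "\<tau> \<in> upper_half_plane" "int_span 1 \<tau> \<in> \<kappa>"
    "sqrt_neg p = of_nat p * (of_int m + of_int n * \<tau>)"
proof -
  let ?r = "sqrt_neg p"
  have r0: "?r \<noteq> 0" using prime_gt_0_nat[OF p] by (simp add: sqrt_neg_def)
  obtain L where L\<kappa>: "L \<in> \<kappa>" using Cl_nonempty[OF \<kappa>] by blast
  note L = Cl_member_proper[OF \<kappa> L\<kappa>]
  obtain x y where xy: "x \<in> quad_field p" "y \<in> quad_field p" "x \<noteq> y" "independent {x, y}"
    and Lxy: "L = int_span x y"
    using L by (auto simp: proper_ideals_def lattice_in_def)
  have Im: "Im (cnj x * y) \<noteq> 0" using independent_imp_Im_cnj_mult_nonzero xy by blast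
  have "?r * x \<in> int_span x y" "?r * y \<in> int_span x y"
    using proper_ideals_mult_closed[OF L R] int_span_generators unfolding Lxy by blast+
  then obtain u w where u: "u \<in> int_span x y" and uw: "int_span (?r * u) w = int_span x y"
    using sqrt_neg_primitive_image[OF p Im] by blast
  define v where "v = ?r * u"
  have vw: "int_span v w = L" using uw by (simp add: v_def Lxy)
  have "L \<subseteq> quad_field p"
  proof
    fix z assume "z \<in> L"
    then obtain m n where z: "z = of_int m * x + of_int n * y" by (auto simp: Lxy int_span_def)
    obtain a b where x: "x = of_rat a + of_rat b * ?r" using xy(1) by (auto simp: quad_field_iff)
    obtain c d where y: "y = of_rat c + of_rat d * ?r" using xy(2) by (auto simp: quad_field_iff)
    have "z = of_rat (of_int m * a + of_int n * c) + of_rat (of_int m * b + of_int n * d) * ?r"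
      unfolding z x y by (simp add: of_rat_add of_rat_mult algebra_simps)
    then show "z \<in> quad_field p" unfolding quad_field_iff by blast
  qed
  then have vK: "v \<in> quad_field p" using int_span_generators(1)[of v w] vw by blast
  have Imvw: "Im (cnj v * w) \<noteq> 0"
  proof
    assume 0: "Im (cnj v * w) = 0"
    obtain a b where x: "x = of_int a * v + of_int b * w"
      using int_span_generators(1)[of x y] unfolding Lxy[symmetric] vw[symmetric] by (rule int_spanE)
    obtain c d where y: "y = of_int c * v + of_int d * w"
      using int_span_generators(2)[of y x] unfolding Lxy[symmetric] vw[symmetric] by (rule int_spanE)
    have "Im (cnj x * y) = of_int (a * d - b * c) * Im (cnj v * w)"
      unfolding x y by (simp add: algebra_simps)
    with 0 Im show False by simp
  qed
  then have v0: "v \<noteq> 0" by auto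
  have "Im (w / v) = Im (cnj v * w) / (cmod v)\<^sup>2"
    by (simp add: Im_divide cmod_power2 algebra_simps)
  then have Imq: "Im (w / v) \<noteq> 0" using Imvw v0 by simp
  \<comment> \<open>the sign that moves \<open>w / v\<close> into the upper half-plane\<close>
  define e :: int where "e = (if Im (w / v) > 0 then 1 else - 1)"
  define \<tau> where "\<tau> = of_int e * (w / v)"
  have \<tau>: "\<tau> \<in> upper_half_plane"
    using Imq by (simp add: \<tau>_def e_def upper_half_plane_def)
  have ww: "w = of_int e * (v * \<tau>)" using v0 by (simp add: \<tau>_def e_def)
  have v\<tau>: "v * \<tau> = of_int e * w" using v0 by (simp add: \<tau>_def)
  have vwt: "int_span v w = int_span v (v * \<tau>)"
  proof (intro equalityI int_span_subset int_span_generators)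
    show "w \<in> int_span v (v * \<tau>)" using mem_int_span[of 0 v e "v * \<tau>"] ww by simp
    show "v * \<tau> \<in> int_span v w" using mem_int_span[of 0 v e w] v\<tau> by simp
  qed
  have scaled: "(\<lambda>z. inverse v * z) ` L = int_span 1 \<tau>"
    unfolding vw[symmetric] vwt image_mult_int_span
    using v0 by (simp add: mult.assoc[symmetric])
  have "int_span 1 \<tau> \<in> \<kappa>"
    unfolding scaled[symmetric] using Cl_scale[OF \<kappa> L\<kappa>] quad_field_inverse[OF vK] v0 by simp
  moreover have "inverse v * u \<in> int_span 1 \<tau>" using u scaled unfolding Lxy by blast
  then obtain m n where mn: "inverse v * u = of_int m + of_int n * \<tau>" by (auto simp: int_span_def)
  have "?r * (inverse v * u) = 1" using v0 by (simp add: v_def field_simps)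
  then have "?r * ?r * (inverse v * u) = ?r" by (simp add: mult.assoc)
  then have "?r = of_nat p * (of_int (- m) + of_int (- n) * \<tau>)"
    unfolding sqrt_neg_square mn by (simp add: algebra_simps)
  ultimately show ?thesis using that \<tau> by blast
qed

section \<open>Uniqueness\<close>

text \<open>
  The base change matrix is invertible over \<open>\<int>\<close>, so its determinant is \<open>\<plusminus>1\<close>; the sign is
  positive because it carries one point of the upper half-plane to another.
\<close>

lemma homothetic_imp_SL2:
  assumes \<sigma>: "\<sigma> \<in> upper_half_plane" and \<tau>: "\<tau> \<in> upper_half_plane"
    and x: "x \<noteq> 0" and eq: "int_span 1 \<tau> = (\<lambda>z. x * z) ` int_span 1 \<sigma>"
  obtains a b c d :: int where "\<tau> = x * (of_int a * \<sigma> + of_int b)"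
    "1 = x * (of_int c * \<sigma> + of_int d)" "a * d - b * c = 1"
proof -
  have "\<tau> \<in> (\<lambda>z. x * z) ` int_span 1 \<sigma>" "1 \<in> (\<lambda>z. x * z) ` int_span 1 \<sigma>"
    using int_span_generators eq by blast+
  then obtain y z where "\<tau> = x * y" "y \<in> int_span 1 \<sigma>" "1 = x * z" "z \<in> int_span 1 \<sigma>" by blast
  then obtain a b c d :: int where ab: "\<tau> = x * (of_int b + of_int a * \<sigma>)"
    and cd: "1 = x * (of_int d + of_int c * \<sigma>)"
    by (elim int_spanE) (simp only: mult_1_right)
  have "x \<in> int_span 1 \<tau>" "x * \<sigma> \<in> int_span 1 \<tau>"
    unfolding eq using imageI[OF int_span_generators(1), of "\<lambda>z. x * z" 1 \<sigma>]
      imageI[OF int_span_generators(2), of "\<lambda>z. x * z" \<sigma> 1] by simp_all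
  then obtain a' b' c' d' :: int where ab': "x * \<sigma> = of_int b' + of_int a' * \<tau>"
    and cd': "x = of_int d' + of_int c' * \<tau>"
    by (auto simp: int_span_def)
  have "x * (of_int 1 + of_int 0 * \<sigma>) = of_int d' * 1 + of_int c' * \<tau>" using cd' by simp
  also have "\<dots> = of_int d' * (x * (of_int d + of_int c * \<sigma>)) + of_int c' * (x * (of_int b + of_int a * \<sigma>))"
    unfolding cd[symmetric] ab[symmetric] ..
  also have "\<dots> = x * (of_int (d' * d + c' * b) + of_int (d' * c + c' * a) * \<sigma>)"
    by (simp add: algebra_simps)
  finally have 1: "1 = d' * d + c' * b" "0 = d' * c + c' * a"
    using x int_combination_one_eq_iff[OF \<sigma>] by (simp_all only: mult_cancel_left) blast+
  have "x * (of_int 0 + of_int 1 * \<sigma>) = of_int b' * 1 + of_int a' * \<tau>" using ab' by simp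
  also have "\<dots> = of_int b' * (x * (of_int d + of_int c * \<sigma>)) + of_int a' * (x * (of_int b + of_int a * \<sigma>))"
    unfolding cd[symmetric] ab[symmetric] ..
  also have "\<dots> = x * (of_int (b' * d + a' * b) + of_int (b' * c + a' * a) * \<sigma>)"
    by (simp add: algebra_simps)
  finally have 2: "0 = b' * d + a' * b" "1 = b' * c + a' * a"
    using x int_combination_one_eq_iff[OF \<sigma>] by (simp_all only: mult_cancel_left) blast+
  have "(a' * d' - b' * c') * (a * d - b * c)
      = (d' * d + c' * b) * (b' * c + a' * a) - (b' * d + a' * b) * (d' * c + c' * a)"
    by (simp add: algebra_simps)
  also have "\<dots> = 1" unfolding 1[symmetric] 2[symmetric] by simp
  finally have "a * d - b * c dvd 1" by (metis dvd_triv_right)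
  moreover have "a * d - b * c > 0"
  proof -
    \<comment> \<open>\<open>Im (A \<sigma>) = det A * Im \<sigma> / \<bar>c \<sigma> + d\<bar>\<^sup>2\<close>, and here \<open>\<bar>c \<sigma> + d\<bar>\<^sup>-\<^sup>1 = \<bar>x\<bar>\<close>\<close>
    have "\<tau> = \<tau> * cnj 1" by simp
    also have "\<dots> = (x * cnj x) * ((of_int b + of_int a * \<sigma>) * (of_int d + of_int c * cnj \<sigma>))"
      by (subst cd, subst ab) (simp add: mult_ac)
    finally have "Im \<tau> = (cmod x)\<^sup>2 * (of_int (a * d - b * c) * Im \<sigma>)"
      unfolding complex_norm_square[symmetric] by (simp add: algebra_simps)
    moreover have "(cmod x)\<^sup>2 > 0" "Im \<tau> > 0" "Im \<sigma> > 0"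
      using x \<sigma> \<tau> by (simp_all add: upper_half_plane_def)
    ultimately have "(of_int (a * d - b * c) :: real) > 0" by (metis zero_less_mult_pos zero_less_mult_pos2)
    then show ?thesis by (simp only: of_int_0_less_iff)
  qed
  ultimately have "a * d - b * c = 1" by simp
  then show ?thesis using that[of a b c d] ab cd by (simp add: add.commute)
qed

lemma homothetic_imp_Gamma0_class:
  assumes p: "p > 0" and \<sigma>: "\<sigma> \<in> upper_half_plane" and \<tau>: "\<tau> \<in> upper_half_plane"
    and x: "x \<noteq> 0" and eq: "int_span 1 \<tau> = (\<lambda>z. x * z) ` int_span 1 \<sigma>"
    and mem\<sigma>: "sqrt_neg p = of_nat p * (of_int m + of_int n * \<sigma>)"
    and mem\<tau>: "sqrt_neg p = of_nat p * (of_int m' + of_int n' * \<tau>)"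
    and closed: "sqrt_neg p * \<sigma> \<in> int_span 1 \<sigma>"
  shows "\<tau> \<in> Gamma0_class p \<sigma>"
proof -
  let ?r = "sqrt_neg p"
  obtain a b c d :: int where ab: "\<tau> = x * (of_int a * \<sigma> + of_int b)"
    and cd: "1 = x * (of_int c * \<sigma> + of_int d)" and det: "a * d - b * c = 1"
    using homothetic_imp_SL2[OF \<sigma> \<tau> x eq] .
  obtain k where k: "?r * \<sigma> = of_int (- k) + of_int (- int p * m) * \<sigma>"
    using sqrt_neg_mult_matrix[OF p \<sigma> mem\<sigma> closed] by metis
  have "of_int m' + of_int n' * \<tau> \<in> (\<lambda>z. x * z) ` int_span 1 \<sigma>"
    unfolding eq[symmetric] using mem_int_span[of m' 1 n' \<tau>] by simp
  then obtain s t where st: "of_int m' + of_int n' * \<tau> = x * (of_int s + of_int t * \<sigma>)"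
    by (auto simp: int_span_def)
  \<comment> \<open>\<open>\<pi> / p \<in> [1,\<tau>]\<close> gives \<open>1 = - \<pi> (\<pi> / p) \<in> \<pi> [1,\<tau>] = x \<pi> [1,\<sigma>]\<close>, and \<open>\<pi> [1,\<sigma>] \<subseteq> [1, p \<sigma>]\<close>\<close>
  have "of_nat p * (- 1) = ?r * ?r" by (simp add: sqrt_neg_square)
  also have "\<dots> = ?r * (of_nat p * (x * (of_int s + of_int t * \<sigma>)))"
    using mem\<tau> unfolding st by metis
  also have "\<dots> = of_nat p * (x * (of_int s * ?r + of_int t * (?r * \<sigma>)))" by (simp add: algebra_simps)
  finally have "- 1 = x * (of_int s * ?r + of_int t * (?r * \<sigma>))"
    using p by (metis mult_cancel_left of_nat_eq_0_iff neq0_conv)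
  also have "\<dots> = x * (of_int s * (of_nat p * (of_int m + of_int n * \<sigma>)) +
      of_int t * (of_int (- k) + of_int (- int p * m) * \<sigma>))"
    unfolding k mem\<sigma>[symmetric] ..
  finally have "x * (of_int (- d) + of_int (- c) * \<sigma>) =
      x * (of_int (s * int p * m - t * k) + of_int (int p * (s * n - t * m)) * \<sigma>)"
    using cd by (simp add: algebra_simps)
  then have "- c = int p * (s * n - t * m)"
    using x int_combination_one_eq_iff[OF \<sigma>] by (simp only: mult_cancel_left) blast
  then have pc: "int p dvd c" by (metis dvd_minus_iff dvd_triv_left)
  define A :: "int^2^2" where "A = vector [vector [a, b], vector [c, d]]"
  have "A \<in> Gamma0 p" using det pc by (simp add: Gamma0_def A_def det_2 vector_2)
  moreover have "\<tau> = moebius_act A \<sigma>"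
  proof -
    have "of_int c * \<sigma> + of_int d \<noteq> 0" using cd by auto
    moreover have "\<tau> * (of_int c * \<sigma> + of_int d) = of_int a * \<sigma> + of_int b"
      using cd by (subst ab) (metis mult.assoc mult.commute mult.right_neutral)
    ultimately show ?thesis by (simp add: moebius_act_def A_def vector_2 field_simps)
  qed
  ultimately show ?thesis by (auto simp: Gamma0_class_def)
qed

theorem lemma2:
  fixes p :: nat and \<kappa> :: "complex set set"
  assumes "prime p" and "odd p"
    and "p mod 4 = 1 \<Longrightarrow> \<kappa> \<in> Cl p (max_order p)"
    and "p mod 4 = 3 \<Longrightarrow> \<kappa> \<in> Cl p (max_order p) \<union> Cl p (order2 p)"
  shows "(\<exists>\<tau>\<in>upper_half_plane. int_span 1 \<tau> \<in> \<kappa> \<and>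
            (\<exists>A\<in>Gamma0 p. moebius_act (omega p) \<tau> = moebius_act A \<tau>)) \<and>
         (\<exists>\<sigma>\<in>upper_half_plane. \<forall>\<tau>\<in>upper_half_plane.
            int_span 1 \<tau> \<in> \<kappa> \<and> (\<exists>A\<in>Gamma0 p. moebius_act (omega p) \<tau> = moebius_act A \<tau>)
              \<longrightarrow> \<tau> \<in> Gamma0_class p \<sigma>)"
proof -
  have p0: "p > 0" using assms(1) prime_gt_0_nat by blast
  have p3: "p \<ge> 3"
    using prime_ge_2_nat[OF assms(1)] assms(2) by (cases "p = 2") auto
  have "p mod 4 = 1 \<or> p mod 4 = 3" using assms(2) by presburger
  then obtain R where R: "\<kappa> \<in> Cl p R" "sqrt_neg p \<in> R"
    using assms(3,4) sqrt_neg_in_max_order[OF assms(1,2)] sqrt_neg_in_order2[of p] by blast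
  have closed: "sqrt_neg p * \<tau> \<in> int_span 1 \<tau>" if "int_span 1 \<tau> \<in> \<kappa>" for \<tau>
    using proper_ideals_mult_closed[OF Cl_member_proper[OF R(1) that] R(2)]
      int_span_generators(2) by blast
  obtain \<sigma> m n where \<sigma>: "\<sigma> \<in> upper_half_plane" "int_span 1 \<sigma> \<in> \<kappa>"
    and mem\<sigma>: "sqrt_neg p = of_nat p * (of_int m + of_int n * \<sigma>)"
    using class_contains_normalized_lattice[OF assms(1) R] .
  have "\<exists>A\<in>Gamma0 p. moebius_act (omega p) \<sigma> = moebius_act A \<sigma>"
    by (rule sqrt_neg_mem_imp_fricke_fixed[OF p0 \<sigma>(1) mem\<sigma> closed[OF \<sigma>(2)]])
  moreover have "\<tau> \<in> Gamma0_class p \<sigma>"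
    if \<tau>: "\<tau> \<in> upper_half_plane" "int_span 1 \<tau> \<in> \<kappa>"
      and A: "A \<in> Gamma0 p" "moebius_act (omega p) \<tau> = moebius_act A \<tau>" for \<tau> A
  proof -
    obtain m' n' where mem\<tau>: "sqrt_neg p = of_nat p * (of_int m' + of_int n' * \<tau>)"
      using fricke_fixed_imp_sqrt_neg_mem[OF p3 \<tau>(1) A] .
    obtain x where x: "x \<noteq> 0" "int_span 1 \<tau> = (\<lambda>z. x * z) ` int_span 1 \<sigma>"
      using Cl_members_homothetic[OF R(1) \<sigma>(2) \<tau>(2)] .
    show ?thesis
      by (rule homothetic_imp_Gamma0_class[OF p0 \<sigma>(1) \<tau>(1) x mem\<sigma> mem\<tau> closed[OF \<sigma>(2)]])
  qed
  ultimately show ?thesis using \<sigma> by blast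
qed

end
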